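(* Let $k\in\mathbb{N}$ and let $\hat{\beta}_k=A^k\hat{\beta}_S+(I_D-A^k)\hat{\beta}_T$ be the estimator obtained by fine-tuning at iteration $k$, with $A=I_D-\alpha\Sigma_T$. For every $x\in\mathbb{R}^D$, with $y$ a new independent target observation at $x$, the gain $\Delta\mathcal{R}_k(x)=\mathbb{E}[(y-x^\top\hat{\beta}_T)^2]-\mathbb{E}[(y-x^\top\hat{\beta}_k)^2]$ satisfies $$\Delta\mathcal{R}_k(x)=x^\top H_k x,\qquad H_k=\sigma_T^2\left(\Sigma_T^{-1}-\alpha^2\,\Omega_k\Sigma_T\Omega_k\right)-\sigma_S^2\,A^k\Sigma_S^{-1}A^k-A^kBA^k,$$ where $\Omega_k=\frac1\alpha\Sigma_T^{-1}(I_D-A^k)$ and $B=(\beta_T-\beta_S)(\beta_T-\beta_S)^\top$. When this quantity is positive, the transfer is beneficial for the sample $(x,y)$ (that is, $\hat{\beta}_k$ has strictly smaller quadratic prediction error at $x$ than $\hat{\beta}_T$), and it is negative (not beneficial) otherwise.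
   Context: Let $D,N_S,N_T$ be positive integers with $D<N_S$ and $D<N_T$. For $\nu\in\{S,T\}$ (source, target), let $X_\nu\in\mathbb{R}^{N_\nu\times D}$ be a deterministic design matrix of full rank, and let $Y_\nu=X_\nu\beta_\nu+\varepsilon_\nu\in\mathbb{R}^{N_\nu}$, where $\beta_\nu\in\mathbb{R}^D$ and $\varepsilon_\nu$ has independent $\mathcal{N}(0,\sigma_\nu^2)$ entries; source and target data are independent. Put $\Sigma_\nu=X_\nu^\top X_\nu$, which is invertible. The least-squares estimators are $\hat{\beta}_\nu=\Sigma_\nu^{-1}X_\nu^\top Y_\nu$. The number $\alpha>0$ is the gradient descent step size; $\hat{\beta}_k$ is the $k$-th iterate of batch gradient descent with step size $\alpha$ on $\beta\mapsto\frac12\|Y_T-X_T\beta\|^2$ started at $\hat{\beta}_S$. $I_D$ is the $D\times D$ identity matrix, and $A^0=I_D$. A new target sample $(x,y)$ consists of a deterministic $x\in\mathbb{R}^D$ and $y=x^\top\beta_T+\varepsilon$ with $\varepsilon\sim\mathcal{N}(0,\sigma_T^2)$ independent of the source and target training data. Expectations are taken with respect to the noise in $y$ and the distribution of the estimators. *)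

theory Defs
  imports "HOL-Probability.Probability"
begin

text \<open>
  The library's \<^const>\<open>normal_density\<close> describes the normal law only for nonzero standard
  deviation; for \<open>\<sigma> = 0\<close> the normal law is the point mass at its mean.
\<close>
definition normal_law :: "real \<Rightarrow> real \<Rightarrow> real measure" where
  "normal_law \<mu> \<sigma> =
     (if \<sigma> = 0 then return borel \<mu> else density lborel (\<lambda>z. ennreal (normal_density \<mu> \<sigma> z)))"

definition gaussian_noise :: "'w measure \<Rightarrow> real \<Rightarrow> ('w \<Rightarrow> real ^ 'n) \<Rightarrow> bool" where
  "gaussian_noise M \<sigma> e \<longleftrightarrow>
     prob_space.indep_vars M (\<lambda>_. borel) (\<lambda>i \<omega>. e \<omega> $ i) UNIV \<and>
     (\<forall>i. distr M borel (\<lambda>\<omega>. e \<omega> $ i) = normal_law 0 \<sigma>)"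

text \<open>
  The library's \<open>indep_var\<close> needs both variables to have the same value type. What follows is its
  characterisation \<open>indep_var_eq\<close>, without that restriction and with Borel target
  algebras, whose preimages form a sigma algebra as they stand.
\<close>
definition indep_borel ::
  "'w measure \<Rightarrow> ('w \<Rightarrow> 'a::topological_space) \<Rightarrow> ('w \<Rightarrow> 'b::topological_space) \<Rightarrow> bool" where
  "indep_borel M X Y \<longleftrightarrow>
     X \<in> borel_measurable M \<and> Y \<in> borel_measurable M \<and>
     prob_space.indep_set M {X -` A \<inter> space M | A. A \<in> sets borel}
                            {Y -` B \<inter> space M | B. B \<in> sets borel}"

text \<open>The instance of \<open>(^)\<close> on \<^typ>\<open>real ^ 'n ^ 'n\<close> is the entrywise power, hence:\<close>
primrec mat_pow :: "real ^ 'n ^ 'n \<Rightarrow> nat \<Rightarrow> real ^ 'n ^ 'n" where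
  "mat_pow A 0 = mat 1"
| "mat_pow A (Suc k) = A ** mat_pow A k"

definition gram :: "real ^ 'd ^ 'n \<Rightarrow> real ^ 'd ^ 'd" where
  "gram X = transpose X ** X"

definition least_squares :: "real ^ 'd ^ 'n \<Rightarrow> real ^ 'n \<Rightarrow> real ^ 'd" where
  "least_squares X y = matrix_inv (gram X) *v (transpose X *v y)"

definition half_square_loss :: "real ^ 'd ^ 'n \<Rightarrow> real ^ 'n \<Rightarrow> real ^ 'd \<Rightarrow> real" where
  "half_square_loss X y b = (norm (y - X *v b))\<^sup>2 / 2"

definition gradient :: "('a::real_inner \<Rightarrow> real) \<Rightarrow> 'a \<Rightarrow> 'a" where
  "gradient f b = (THE g. GDERIV f b :> g)"

primrec grad_descent :: "real \<Rightarrow> ('a::real_inner \<Rightarrow> real) \<Rightarrow> 'a \<Rightarrow> nat \<Rightarrow> 'a" where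
  "grad_descent \<alpha> f b0 0 = b0"
| "grad_descent \<alpha> f b0 (Suc k) =
     grad_descent \<alpha> f b0 k - \<alpha> *\<^sub>R gradient f (grad_descent \<alpha> f b0 k)"

definition descent_matrix :: "real \<Rightarrow> real ^ 'd ^ 'n \<Rightarrow> real ^ 'd ^ 'd" where
  "descent_matrix \<alpha> X = mat 1 - \<alpha> *\<^sub>R gram X"

definition Omega :: "real \<Rightarrow> real ^ 'd ^ 'n \<Rightarrow> nat \<Rightarrow> real ^ 'd ^ 'd" where
  "Omega \<alpha> X k =
     (1 / \<alpha>) *\<^sub>R (matrix_inv (gram X) ** (mat 1 - mat_pow (descent_matrix \<alpha> X) k))"

definition outer :: "real ^ 'd \<Rightarrow> real ^ 'd ^ 'd" where
  "outer v = (\<chi> i j. v $ i * v $ j)"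

definition gain_matrix ::
  "real \<Rightarrow> real ^ 'd ^ 's \<Rightarrow> real ^ 'd ^ 't \<Rightarrow> real ^ 'd \<Rightarrow> real ^ 'd \<Rightarrow> real \<Rightarrow> real \<Rightarrow> nat
    \<Rightarrow> real ^ 'd ^ 'd" where
  "gain_matrix \<alpha> X\<^sub>S X\<^sub>T \<beta>\<^sub>S \<beta>\<^sub>T \<sigma>\<^sub>S \<sigma>\<^sub>T k =
     (let Ak = mat_pow (descent_matrix \<alpha> X\<^sub>T) k;
          \<Omega> = Omega \<alpha> X\<^sub>T k;
          B = outer (\<beta>\<^sub>T - \<beta>\<^sub>S)
      in \<sigma>\<^sub>T\<^sup>2 *\<^sub>R (matrix_inv (gram X\<^sub>T) - \<alpha>\<^sup>2 *\<^sub>R (\<Omega> ** gram X\<^sub>T ** \<Omega>))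
         - \<sigma>\<^sub>S\<^sup>2 *\<^sub>R (Ak ** matrix_inv (gram X\<^sub>S) ** Ak)
         - Ak ** B ** Ak)"

definition prediction_risk ::
  "'w measure \<Rightarrow> ('w \<Rightarrow> real) \<Rightarrow> real ^ 'd \<Rightarrow> ('w \<Rightarrow> real ^ 'd) \<Rightarrow> real" where
  "prediction_risk M y x b = prob_space.expectation M (\<lambda>\<omega>. (y \<omega> - x \<bullet> b \<omega>)\<^sup>2)"

definition transfer_gain ::
  "'w measure \<Rightarrow> ('w \<Rightarrow> real) \<Rightarrow> real ^ 'd \<Rightarrow> ('w \<Rightarrow> real ^ 'd) \<Rightarrow> ('w \<Rightarrow> real ^ 'd) \<Rightarrow> real" where
  "transfer_gain M y x b_target b_tuned =
     prediction_risk M y x b_target - prediction_risk M y x b_tuned"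

definition transfer_beneficial ::
  "'w measure \<Rightarrow> ('w \<Rightarrow> real) \<Rightarrow> real ^ 'd \<Rightarrow> ('w \<Rightarrow> real ^ 'd) \<Rightarrow> ('w \<Rightarrow> real ^ 'd) \<Rightarrow> bool" where
  "transfer_beneficial M y x b_target b_tuned \<longleftrightarrow>
     prediction_risk M y x b_tuned < prediction_risk M y x b_target"

end

theory Submission
  imports Defs
begin

text \<open>
  Write \<open>P = A\<^sup>k\<close>, \<open>u = P x\<close> and \<open>w = (I - P) x\<close>. The gradient of the loss at \<open>b\<close> is the
  target Gram matrix applied to the deviation of \<open>b\<close> from the target least-squares estimator, so one
  descent step multiplies that deviation by \<open>A\<close>
  (\<open>grad_descent_half_square_loss\<close>). Since \<open>P\<close> is symmetric, the prediction of the tuned estimator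
  at \<open>x\<close> is the inner product of \<open>u\<close> with the source estimator plus that of \<open>w\<close> with the target
  estimator.

  A linear functional of a least-squares estimator is its value at the true parameter plus a linear
  combination of the noise entries (\<open>inner_least_squares\<close>), and the squared length of the weight
  vector is the quadratic form of the inverse Gram matrix (\<open>norm_least_squares_weights\<close>). Hence the
  prediction error of each estimator is a constant (the bias: \<open>0\<close> for the target estimator,
  \<open>u \<bullet> (\<beta>\<^sub>T - \<beta>\<^sub>S)\<close> for the tuned one) plus three independent centred variables, which come from
  the new observation, the source noise and the target noise. The mean square of such a sum is the
  squared constant plus the three variances (\<open>expectation_square_noise\<close>). In the difference of the
  two risks the variance of the new observation cancels; what remains is the quadratic form of the
  gain matrix, because the inverse target Gram matrix commutes with \<open>A\<close>
  (\<open>gain_matrix_quadratic_form\<close>).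
\<close>

section \<open>Gram matrices and least squares\<close>

lemma inner_matrix_vector_adjoint:
  fixes A :: "real ^ 'n ^ 'm"
  shows "x \<bullet> (A *v y) = (transpose A *v x) \<bullet> y"
  by (simp add: dot_lmul_matrix)

lemma inner_symmetric_matrix_vector:
  fixes A :: "real ^ 'n ^ 'n"
  assumes "transpose A = A"
  shows "x \<bullet> (A *v y) = (A *v x) \<bullet> y"
  using inner_matrix_vector_adjoint[of x A y] assms by simp

lemma inner_gram: "v \<bullet> (gram X *v w) = (X *v v) \<bullet> (X *v w)"
proof -
  have "v \<bullet> (gram X *v w) = v \<bullet> (transpose X *v (X *v w))"
    by (simp only: gram_def matrix_vector_mul_assoc)
  also have "\<dots> = (X *v v) \<bullet> (X *v w)"
    by (simp only: inner_matrix_vector_adjoint transpose_transpose)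
  finally show ?thesis .
qed

lemma transpose_gram: "transpose (gram X) = gram X"
  by (simp add: gram_def matrix_transpose_mul)

lemma invertible_gram:
  fixes X :: "real ^ 'd ^ 'n"
  assumes "rank X = CARD('d)"
  shows "invertible (gram X)"
proof -
  have "v = 0" if "gram X *v v = 0" for v
  proof -
    have "(X *v v) \<bullet> (X *v v) = 0"
      using inner_gram[of v X v] that by simp
    then show "v = 0"
      using assms matrix_nonfull_linear_equations_eq[of X] by auto
  qed
  then show ?thesis
    by (simp add: invertible_left_inverse matrix_left_invertible_ker)
qed

lemma
  fixes A :: "real ^ 'n ^ 'n"
  assumes "invertible A"
  shows matrix_inv_right: "A ** matrix_inv A = mat 1"
    and matrix_inv_left: "matrix_inv A ** A = mat 1"
proof -
  have "A ** matrix_inv A = mat 1 \<and> matrix_inv A ** A = mat 1"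
    using assms unfolding invertible_def matrix_inv_def by (rule someI_ex)
  then show "A ** matrix_inv A = mat 1" and "matrix_inv A ** A = mat 1"
    by auto
qed

lemma transpose_matrix_inv:
  fixes A :: "real ^ 'n ^ 'n"
  assumes "invertible A"
  shows "transpose (matrix_inv A) = matrix_inv (transpose A)"
proof -
  have "transpose A ** transpose (matrix_inv A) = mat 1"
    using matrix_inv_left[OF assms] by (metis matrix_transpose_mul transpose_mat)
  moreover have "matrix_inv (transpose A) ** transpose A = mat 1"
    by (intro matrix_inv_left transpose_invertible assms)
  ultimately show ?thesis
    by (metis matrix_mul_assoc matrix_mul_lid matrix_mul_rid)
qed

text \<open>
  The estimator reproduces \<open>\<beta>\<close> exactly on noiseless data, and moving the symmetric inverse and the
  transposed design to the other side of the inner product turns the remaining term into a weighted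
  sum of the entries of \<open>e\<close>.
\<close>
lemma inner_least_squares:
  fixes X :: "real ^ 'd ^ 'n"
  assumes "rank X = CARD('d)"
  shows "v \<bullet> least_squares X (X *v \<beta> + e) = v \<bullet> \<beta> + (X *v (matrix_inv (gram X) *v v)) \<bullet> e"
proof -
  note inv = invertible_gram[OF assms]
  have sym: "transpose (matrix_inv (gram X)) = matrix_inv (gram X)"
    by (simp add: transpose_matrix_inv[OF inv] transpose_gram)
  have "v \<bullet> least_squares X (X *v \<beta> + e)
      = v \<bullet> (matrix_inv (gram X) *v (gram X *v \<beta>)) + v \<bullet> (matrix_inv (gram X) *v (transpose X *v e))"
    by (simp only: least_squares_def gram_def matrix_vector_right_distrib inner_add_right
        matrix_vector_mul_assoc)
  also have "matrix_inv (gram X) *v (gram X *v \<beta>) = \<beta>"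
    by (simp only: matrix_vector_mul_assoc matrix_inv_left[OF inv] matrix_vector_mul_lid)
  also have "v \<bullet> (matrix_inv (gram X) *v (transpose X *v e))
      = (X *v (matrix_inv (gram X) *v v)) \<bullet> e"
    by (simp only: inner_matrix_vector_adjoint sym transpose_transpose)
  finally show ?thesis .
qed

text \<open>
  For noise with independent entries of variance \<open>\<sigma>\<^sup>2\<close>, the variance of a weighted sum is \<open>\<sigma>\<^sup>2\<close>
  times the squared norm of the weights; for the weights of \<open>inner_least_squares\<close>, one of the two
  inverses in that norm cancels against the Gram matrix.
\<close>
lemma norm_least_squares_weights:
  fixes X :: "real ^ 'd ^ 'n"
  assumes "rank X = CARD('d)"
  shows "(norm (X *v (matrix_inv (gram X) *v v)))\<^sup>2 = v \<bullet> (matrix_inv (gram X) *v v)"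
proof -
  let ?S = "matrix_inv (gram X)"
  have "(norm (X *v (?S *v v)))\<^sup>2 = (?S *v v) \<bullet> (gram X *v (?S *v v))"
    by (simp only: power2_norm_eq_inner inner_gram)
  also have "gram X *v (?S *v v) = v"
    by (simp only: matrix_vector_mul_assoc matrix_inv_right[OF invertible_gram[OF assms]]
        matrix_vector_mul_lid)
  finally show ?thesis
    by (simp only: inner_commute)
qed

section \<open>Gradient descent in closed form\<close>

lemma gradient_eqI:
  assumes "GDERIV f b :> g"
  shows "gradient f b = g"
  unfolding gradient_def
proof (rule the_equality)
  show "GDERIV f b :> g"
    by (rule assms)
next
  fix g' assume "GDERIV f b :> g'"
  then have "(\<lambda>h. h \<bullet> g') = (\<lambda>h. h \<bullet> g)"
    using assms has_derivative_unique unfolding gderiv_def by blast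
  then have "(g' - g) \<bullet> g' = (g' - g) \<bullet> g"
    by metis
  then have "(g' - g) \<bullet> (g' - g) = 0"
    by (simp only: inner_diff_right)
  then show "g' = g"
    by simp
qed

lemma gradient_half_square_loss:
  fixes X :: "real ^ 'd ^ 'n"
  shows "gradient (half_square_loss X y) b = transpose X *v (X *v b - y)"
proof (rule gradient_eqI)
  have D: "((\<lambda>b. y - X *v b) has_derivative (\<lambda>h. - (X *v h))) (at b)"
    by (auto intro!: derivative_eq_intros bounded_linear_imp_has_derivative)
  have "((\<lambda>b. ((y - X *v b) \<bullet> (y - X *v b)) / 2) has_derivative
      (\<lambda>h. ((y - X *v b) \<bullet> (- (X *v h)) + (- (X *v h)) \<bullet> (y - X *v b)) / 2)) (at b)"
    by (rule bounded_linear.has_derivative[OF bounded_linear_divide has_derivative_inner[OF D D]])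
  also have "(\<lambda>h. ((y - X *v b) \<bullet> (- (X *v h)) + (- (X *v h)) \<bullet> (y - X *v b)) / 2)
      = (\<lambda>h. h \<bullet> (transpose X *v (X *v b - y)))"
    by (simp only: inner_matrix_vector_adjoint transpose_transpose)
       (simp add: inner_commute inner_diff_left inner_diff_right diff_divide_distrib)
  finally show "GDERIV (half_square_loss X y) b :> transpose X *v (X *v b - y)"
    by (simp add: gderiv_def half_square_loss_def[abs_def] power2_norm_eq_inner)
qed

text \<open>
  The least-squares estimator is the fixed point of the affine descent step, so the deviation from it
  evolves linearly.
\<close>
lemma grad_descent_half_square_loss:
  fixes X :: "real ^ 'd ^ 'n"
  assumes "rank X = CARD('d)"
  shows "grad_descent \<alpha> (half_square_loss X y) b\<^sub>0 k =
    mat_pow (descent_matrix \<alpha> X) k *v b\<^sub>0 +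
    (mat 1 - mat_pow (descent_matrix \<alpha> X) k) *v least_squares X y"
proof -
  let ?A = "descent_matrix \<alpha> X" and ?b = "least_squares X y"
  let ?g = "grad_descent \<alpha> (half_square_loss X y) b\<^sub>0"
  have normal_equation: "gram X *v ?b = transpose X *v y"
    by (simp only: least_squares_def matrix_vector_mul_assoc matrix_mul_assoc
        matrix_inv_right[OF invertible_gram[OF assms]] matrix_mul_lid)
  have error_step: "?g (Suc k) - ?b = ?A *v (?g k - ?b)" for k
  proof -
    have "gradient (half_square_loss X y) (?g k) = gram X *v ?g k - gram X *v ?b"
      by (simp only: gradient_half_square_loss normal_equation)
        (simp only: gram_def matrix_vector_mult_diff_distrib matrix_vector_mul_assoc)
    then show ?thesis
      by (simp only: grad_descent.simps)
        (simp add: descent_matrix_def matrix_vector_mult_diff_rdistrib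
          matrix_vector_mult_diff_distrib scaleR_matrix_vector_assoc [symmetric] scaleR_diff_right)
  qed
  have "?g k - ?b = mat_pow ?A k *v (b\<^sub>0 - ?b)"
  proof (induction k)
    case (Suc k)
    show ?case
      by (simp only: error_step Suc.IH mat_pow.simps matrix_vector_mul_assoc)
  qed simp
  then show ?thesis
    by (simp add: matrix_vector_mult_diff_rdistrib matrix_vector_mult_diff_distrib algebra_simps)
qed

section \<open>The gain matrix as a quadratic form\<close>

lemma mat_pow_commute:
  fixes A B :: "real ^ 'n ^ 'n"
  assumes "B ** A = A ** B"
  shows "B ** mat_pow A k = mat_pow A k ** B"
proof (induction k)
  case (Suc k)
  then show ?case
    by (metis assms mat_pow.simps(2) matrix_mul_assoc)
qed simp

lemma transpose_mat_pow:
  fixes A :: "real ^ 'n ^ 'n"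
  assumes "transpose A = A"
  shows "transpose (mat_pow A k) = mat_pow A k"
proof (induction k)
  case (Suc k)
  then show ?case
    by (simp add: matrix_transpose_mul assms mat_pow_commute)
qed simp

lemma transpose_diff: "transpose (A - B) = transpose A - transpose (B :: real ^ 'n ^ 'm)"
  by (simp add: transpose_def vec_eq_iff)

lemma inner_outer: "x \<bullet> (outer v *v x) = (x \<bullet> v)\<^sup>2"
proof -
  have "outer v *v x = (x \<bullet> v) *\<^sub>R v"
    by (simp add: vec_eq_iff outer_def matrix_vector_mult_def inner_vec_def sum_distrib_left
        sum_distrib_right mult_ac)
  then show ?thesis
    by (simp add: power2_eq_square)
qed

lemma matrix_inv_gram_commute_descent_matrix:
  fixes X :: "real ^ 'd ^ 'n"
  assumes "rank X = CARD('d)"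
  shows "matrix_inv (gram X) ** descent_matrix \<alpha> X = descent_matrix \<alpha> X ** matrix_inv (gram X)"
proof -
  let ?S = "matrix_inv (gram X)"
  note inv = invertible_gram[OF assms]
  have "(?S ** descent_matrix \<alpha> X) *v v = (descent_matrix \<alpha> X ** ?S) *v v" for v
  proof -
    have "?S *v (gram X *v v) = gram X *v (?S *v v)"
      by (simp only: matrix_vector_mul_assoc matrix_inv_left[OF inv] matrix_inv_right[OF inv])
    then show ?thesis
      by (simp add: matrix_vector_mul_assoc [symmetric] descent_matrix_def
          matrix_vector_mult_diff_rdistrib matrix_vector_mult_diff_distrib
          scaleR_matrix_vector_assoc [symmetric] matrix_vector_mult_scaleR)
  qed
  then show ?thesis
    by (simp add: matrix_eq)
qed

text \<open>
  The scalar \<open>\<alpha>\<close> cancels in \<open>\<alpha> \<Omega>\<close>, which is the inverse Gram matrix times \<open>I - P\<close>. The middle factor of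
  \<open>\<alpha>\<^sup>2 \<Omega> \<Sigma> \<Omega>\<close> cancels against one of the two inverses, and the other one can be moved between the two
  copies of \<open>I - P\<close>, with which it commutes.
\<close>
lemma gain_matrix_quadratic_form:
  fixes X\<^sub>S :: "real ^ 'd ^ 's" and X\<^sub>T :: "real ^ 'd ^ 't" and k :: nat and x :: "real ^ 'd"
  assumes "rank X\<^sub>T = CARD('d)" and "\<alpha> \<noteq> 0"
  defines "P \<equiv> mat_pow (descent_matrix \<alpha> X\<^sub>T) k"
  defines "u \<equiv> P *v x" and "w \<equiv> (mat 1 - P) *v x"
  shows "x \<bullet> (gain_matrix \<alpha> X\<^sub>S X\<^sub>T \<beta>\<^sub>S \<beta>\<^sub>T \<sigma>\<^sub>S \<sigma>\<^sub>T k *v x) =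
    \<sigma>\<^sub>T\<^sup>2 * (x \<bullet> (matrix_inv (gram X\<^sub>T) *v x) - w \<bullet> (matrix_inv (gram X\<^sub>T) *v w))
    - \<sigma>\<^sub>S\<^sup>2 * (u \<bullet> (matrix_inv (gram X\<^sub>S) *v u)) - (u \<bullet> (\<beta>\<^sub>T - \<beta>\<^sub>S))\<^sup>2"
proof -
  let ?S = "matrix_inv (gram X\<^sub>T)" and ?Q = "mat 1 - P" and ?\<Omega> = "Omega \<alpha> X\<^sub>T k"
  have "transpose (descent_matrix \<alpha> X\<^sub>T) = descent_matrix \<alpha> X\<^sub>T"
    by (simp add: descent_matrix_def transpose_diff transpose_scalar transpose_gram)
  then have symP: "transpose P = P"
    by (simp add: P_def transpose_mat_pow)
  then have symQ: "transpose ?Q = ?Q"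
    by (simp add: transpose_diff)
  have "?S ** P = P ** ?S"
    by (simp add: P_def mat_pow_commute matrix_inv_gram_commute_descent_matrix[OF assms(1)])
  then have "?S *v (P *v v) = P *v (?S *v v)" for v
    by (simp only: matrix_vector_mul_assoc)
  then have SQ: "?S *v (?Q *v v) = ?Q *v (?S *v v)" for v
    by (simp add: matrix_vector_mult_diff_rdistrib matrix_vector_mult_diff_distrib
        matrix_vector_mul_assoc [symmetric])
  have \<Omega>: "\<alpha> *\<^sub>R (?\<Omega> *v v) = ?S *v (?Q *v v)" for v
    using assms(2) by (simp add: Omega_def P_def [symmetric] scaleR_matrix_vector_assoc [symmetric]
        matrix_vector_mul_assoc [symmetric])
  have "\<alpha>\<^sup>2 *\<^sub>R (?\<Omega> *v (gram X\<^sub>T *v (?\<Omega> *v x)))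
      = \<alpha> *\<^sub>R (?\<Omega> *v (gram X\<^sub>T *v (\<alpha> *\<^sub>R (?\<Omega> *v x))))"
    by (simp add: matrix_vector_mult_scaleR power2_eq_square)
  also have "\<dots> = ?S *v (?Q *v (gram X\<^sub>T *v (?S *v w)))"
    by (simp only: \<Omega> w_def)
  also have "gram X\<^sub>T *v (?S *v w) = w"
    by (simp only: matrix_vector_mul_assoc matrix_inv_right[OF invertible_gram[OF assms(1)]]
        matrix_vector_mul_lid)
  finally have "x \<bullet> (\<alpha>\<^sup>2 *\<^sub>R (?\<Omega> *v (gram X\<^sub>T *v (?\<Omega> *v x)))) = w \<bullet> (?S *v w)"
    by (simp only: SQ inner_symmetric_matrix_vector[OF symQ] w_def)
  moreover have "x \<bullet> (P *v v) = u \<bullet> v" for v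
    by (simp only: inner_symmetric_matrix_vector[OF symP] u_def)
  ultimately show ?thesis
    by (simp add: gain_matrix_def Let_def P_def [symmetric] u_def [symmetric]
        matrix_vector_mult_diff_rdistrib scaleR_matrix_vector_assoc [symmetric]
        matrix_vector_mul_assoc [symmetric] inner_diff_right inner_outer right_diff_distrib)
qed

section \<open>Second moments of independent noise\<close>

text \<open>
  Here \<open>v\<close> is the variance, which equals the second moment as the mean is zero. Stating both moments
  by \<open>has_bochner_integral\<close> includes integrability, and so excludes the default value \<open>0\<close> of the
  integral of a function that is not integrable.
\<close>
definition centred :: "'w measure \<Rightarrow> ('w \<Rightarrow> real) \<Rightarrow> real \<Rightarrow> bool" where
  "centred M Z v \<longleftrightarrow> has_bochner_integral M Z 0 \<and> has_bochner_integral M (\<lambda>\<omega>. (Z \<omega>)\<^sup>2) v"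

text \<open>
  Both moments are integrals against the law. In the degenerate case \<open>\<sigma> = 0\<close> that law is a point
  mass, not a density, and is treated separately.
\<close>
lemma (in prob_space) centred_normal_law:
  assumes "random_variable borel Z" and "distr M borel Z = normal_law 0 \<sigma>" and "\<sigma> \<ge> 0"
  shows "centred M Z (\<sigma>\<^sup>2)"
proof -
  have transfer: "has_bochner_integral M (\<lambda>\<omega>. f (Z \<omega>)) m"
    if "has_bochner_integral (normal_law 0 \<sigma>) f m" "f \<in> borel_measurable borel"
    for f :: "real \<Rightarrow> real" and m
    using that assms(1) unfolding assms(2) [symmetric]
    by (simp add: has_bochner_integral_iff integrable_distr_eq integral_distr)
  have "has_bochner_integral (normal_law 0 \<sigma>) (\<lambda>z. z) 0 \<and>
    has_bochner_integral (normal_law 0 \<sigma>) (\<lambda>z. z\<^sup>2) (\<sigma>\<^sup>2)"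
  proof (cases "\<sigma> = 0")
    case True
    have "integrable (return borel (0::real)) f \<and> integral\<^sup>L (return borel 0) f = f 0"
      if "f \<in> borel_measurable borel" for f :: "real \<Rightarrow> real"
    proof -
      have "integrable (return borel (0::real)) f"
        using that by (subst integrable_iff_bounded) (simp add: nn_integral_return)
      then show ?thesis
        using that by (simp add: integral_return)
    qed
    then show ?thesis
      using True by (simp add: normal_law_def has_bochner_integral_iff)
  next
    case False
    then have \<sigma>: "0 < \<sigma>"
      using assms(3) by simp
    have "has_bochner_integral lborel (\<lambda>z. normal_density 0 \<sigma> z * z\<^sup>2) (\<sigma>\<^sup>2)"
      using normal_moment_even[OF \<sigma>, of 0 1] by (simp add: fact_numeral)
    then show ?thesis
      using normal_moment_nz_1[OF \<sigma>, of 0] False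
      by (simp add: normal_law_def has_bochner_integral_density)
  qed
  then show ?thesis
    unfolding centred_def
    by (intro conjI transfer[of "\<lambda>z. z" 0] transfer[of "\<lambda>z. z\<^sup>2" "\<sigma>\<^sup>2"]) simp_all
qed

lemma (in prob_space) centred_add_indep:
  assumes "centred M Z v" "centred M Z' v'" and "indep_var borel Z borel Z'"
  shows "centred M (\<lambda>\<omega>. Z \<omega> + Z' \<omega>) (v + v')"
proof -
  have int: "has_bochner_integral M Z 0" "has_bochner_integral M Z' 0"
    "has_bochner_integral M (\<lambda>\<omega>. (Z \<omega>)\<^sup>2) v" "has_bochner_integral M (\<lambda>\<omega>. (Z' \<omega>)\<^sup>2) v'"
    using assms(1,2) by (auto simp: centred_def)
  have "has_bochner_integral M (\<lambda>\<omega>. Z \<omega> * Z' \<omega>) 0"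
    using int(1,2) indep_var_integrable[OF assms(3)] indep_var_lebesgue_integral[OF assms(3)]
    by (simp add: has_bochner_integral_iff)
  from has_bochner_integral_add[OF has_bochner_integral_add[OF int(3,4)]
      has_bochner_integral_mult_right[where c = 2, OF this]]
  have "has_bochner_integral M (\<lambda>\<omega>. (Z \<omega> + Z' \<omega>)\<^sup>2) (v + v')"
    by (simp add: power2_sum algebra_simps)
  then show ?thesis
    using has_bochner_integral_add[OF int(1,2)] by (simp add: centred_def)
qed

lemma centred_mult:
  assumes "centred M Z v"
  shows "centred M (\<lambda>\<omega>. c * Z \<omega>) (c\<^sup>2 * v)"
proof -
  have Z: "has_bochner_integral M Z 0" "has_bochner_integral M (\<lambda>\<omega>. (Z \<omega>)\<^sup>2) v"
    using assms by (auto simp: centred_def)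
  show ?thesis
    using has_bochner_integral_mult_right[where c = c, OF Z(1)]
      has_bochner_integral_mult_right[where c = "c\<^sup>2", OF Z(2)]
    by (simp add: centred_def power_mult_distrib)
qed

lemma (in prob_space) centred_gaussian_noise:
  fixes e :: "'a \<Rightarrow> real ^ 'n"
  assumes "gaussian_noise M \<sigma> e" and "\<sigma> \<ge> 0"
  shows "centred M (\<lambda>\<omega>. u \<bullet> e \<omega>) (\<sigma>\<^sup>2 * (norm u)\<^sup>2)"
proof -
  have indep: "indep_vars (\<lambda>_. borel) (\<lambda>i \<omega>. e \<omega> $ i) UNIV"
    and law: "distr M borel (\<lambda>\<omega>. e \<omega> $ i) = normal_law 0 \<sigma>" for i
    using assms(1) by (auto simp: gaussian_noise_def)
  \<comment> \<open>Each entry is independent of the partial sum of the others, so the variances add one by one.\<close>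
  have indep_scaled: "indep_vars (\<lambda>_. borel) (\<lambda>i \<omega>. u $ i * e \<omega> $ i) I" for I
    by (rule indep_vars_subset[OF indep_vars_compose2[OF indep]]) auto
  have entry: "centred M (\<lambda>\<omega>. u $ i * e \<omega> $ i) ((u $ i)\<^sup>2 * \<sigma>\<^sup>2)" for i
    using indep law assms(2) by (intro centred_mult centred_normal_law) (auto simp: indep_vars_def)
  have "centred M (\<lambda>\<omega>. \<Sum>i\<in>I. u $ i * e \<omega> $ i) (\<Sum>i\<in>I. (u $ i)\<^sup>2 * \<sigma>\<^sup>2)" for I :: "'n set"
  proof (induction I rule: infinite_finite_induct)
    case (insert i I)
    then show ?case
      using centred_add_indep[OF entry insert.IH indep_vars_sum[OF insert(1,2) indep_scaled]]
      by simp
  qed (simp_all add: centred_def has_bochner_integral_zero)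
  from this[of UNIV]
  have "centred M (\<lambda>\<omega>. u \<bullet> e \<omega>) (\<Sum>i\<in>UNIV. (u $ i)\<^sup>2 * \<sigma>\<^sup>2)"
    by (simp only: inner_vec_def inner_real_def)
  also have "(\<Sum>i\<in>UNIV. (u $ i)\<^sup>2 * \<sigma>\<^sup>2) = \<sigma>\<^sup>2 * (norm u)\<^sup>2"
    by (simp only: power2_norm_eq_inner inner_vec_def inner_real_def sum_distrib_left)
      (simp add: power2_eq_square mult_ac)
  finally show ?thesis .
qed

text \<open>
  Samples of different sizes have different types, but real functions of them are variables of one
  type. Independence passes to these, because preimages under \<open>f \<circ> X\<close> are preimages under \<open>X\<close>.
\<close>
lemma (in prob_space) indep_var_compose_indep_borel:
  fixes f :: "'b::topological_space \<Rightarrow> real" and g :: "'c::topological_space \<Rightarrow> real"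
  assumes "indep_borel M X Y" and "f \<in> borel_measurable borel" "g \<in> borel_measurable borel"
  shows "indep_var borel (\<lambda>\<omega>. f (X \<omega>)) borel (\<lambda>\<omega>. g (Y \<omega>))"
proof -
  let ?preimages = "\<lambda>Z. {Z -` A \<inter> space M | A. A \<in> sets borel}"
  have meas: "X \<in> borel_measurable M" "Y \<in> borel_measurable M"
    and indep: "indep_set (?preimages X) (?preimages Y)"
    using assms(1) by (auto simp: indep_borel_def)
  have preimages_compose: "?preimages (\<lambda>\<omega>. h (Z \<omega>)) \<subseteq> ?preimages Z"
    if "h \<in> borel_measurable borel"
    for h :: "'z::topological_space \<Rightarrow> 'r::topological_space" and Z :: "'a \<Rightarrow> 'z"
  proof clarify
    fix A :: "'r set" assume "A \<in> sets borel"
    then have "h -` A \<in> sets borel"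
      using measurable_sets[OF that, of A] by simp
    then show "\<exists>B. (\<lambda>\<omega>. h (Z \<omega>)) -` A \<inter> space M = Z -` B \<inter> space M \<and> B \<in> sets borel"
      by (intro exI[of _ "h -` A"]) auto
  qed
  have stable: "Int_stable (?preimages Z)" for Z :: "'a \<Rightarrow> real"
  proof (rule Int_stableI, clarify)
    fix A B :: "real set" assume "A \<in> sets borel" "B \<in> sets borel"
    then show "\<exists>C. Z -` A \<inter> space M \<inter> (Z -` B \<inter> space M) = Z -` C \<inter> space M \<and> C \<in> sets borel"
      by (intro exI[of _ "A \<inter> B"]) auto
  qed
  have indep_set_mono: "indep_set C D" if "indep_set A B" "C \<subseteq> A" "D \<subseteq> B" for A B C D
    using that unfolding indep_sets2_eq by blast
  have "indep_set (?preimages (\<lambda>\<omega>. f (X \<omega>))) (?preimages (\<lambda>\<omega>. g (Y \<omega>)))"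
    by (rule indep_set_mono[OF indep preimages_compose[OF assms(2)] preimages_compose[OF assms(3)]])
  then have "indep_set (sigma_sets (space M) (?preimages (\<lambda>\<omega>. f (X \<omega>))))
      (sigma_sets (space M) (?preimages (\<lambda>\<omega>. g (Y \<omega>))))"
    by (rule indep_set_sigma_sets[OF _ stable stable])
  then show ?thesis
    using meas assms(2,3) unfolding indep_var_eq by simp
qed

text \<open>
  The observations are the noise shifted by constants, so independence of the observations passes to
  the noise. It is used twice: between the two samples, and between the new noise and the sum of the
  two contributions, which is a function of the pair of samples. Expanding the square leaves a cross
  term proportional to the mean of the total noise, which vanishes.
\<close>
lemma (in prob_space) expectation_square_noise:
  fixes e\<^sub>S Y\<^sub>S :: "'a \<Rightarrow> real ^ 's" and e\<^sub>T Y\<^sub>T :: "'a \<Rightarrow> real ^ 't"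
  assumes "\<sigma>\<^sub>S \<ge> 0" "\<sigma>\<^sub>T \<ge> 0" "gaussian_noise M \<sigma>\<^sub>S e\<^sub>S" "gaussian_noise M \<sigma>\<^sub>T e\<^sub>T"
    and Y: "\<And>\<omega>. Y\<^sub>S \<omega> = m\<^sub>S + e\<^sub>S \<omega>" "\<And>\<omega>. Y\<^sub>T \<omega> = m\<^sub>T + e\<^sub>T \<omega>"
    and "indep_borel M Y\<^sub>S Y\<^sub>T" and "distr M borel \<epsilon> = normal_law 0 \<sigma>\<^sub>T"
    and indep_new: "indep_borel M \<epsilon> (\<lambda>\<omega>. (Y\<^sub>S \<omega>, Y\<^sub>T \<omega>))"
  shows "expectation (\<lambda>\<omega>. (c + (\<epsilon> \<omega> + (u \<bullet> e\<^sub>S \<omega> + w \<bullet> e\<^sub>T \<omega>)))\<^sup>2) =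
    c\<^sup>2 + \<sigma>\<^sub>T\<^sup>2 + \<sigma>\<^sub>S\<^sup>2 * (norm u)\<^sup>2 + \<sigma>\<^sub>T\<^sup>2 * (norm w)\<^sup>2"
proof -
  have e: "e\<^sub>S \<omega> = Y\<^sub>S \<omega> - m\<^sub>S" "e\<^sub>T \<omega> = Y\<^sub>T \<omega> - m\<^sub>T" for \<omega>
    by (simp_all add: Y)
  let ?Z = "\<lambda>\<omega>. \<epsilon> \<omega> + (u \<bullet> e\<^sub>S \<omega> + w \<bullet> e\<^sub>T \<omega>)"
  have "indep_var borel (\<lambda>\<omega>. u \<bullet> (Y\<^sub>S \<omega> - m\<^sub>S)) borel (\<lambda>\<omega>. w \<bullet> (Y\<^sub>T \<omega> - m\<^sub>T))"
    by (intro indep_var_compose_indep_borel[OF assms(7)]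
        borel_measurable_continuous_onI continuous_intros)
  then have "indep_var borel (\<lambda>\<omega>. u \<bullet> e\<^sub>S \<omega>) borel (\<lambda>\<omega>. w \<bullet> e\<^sub>T \<omega>)"
    by (simp only: e)
  then have "centred M (\<lambda>\<omega>. u \<bullet> e\<^sub>S \<omega> + w \<bullet> e\<^sub>T \<omega>) (\<sigma>\<^sub>S\<^sup>2 * (norm u)\<^sup>2 + \<sigma>\<^sub>T\<^sup>2 * (norm w)\<^sup>2)"
    using assms by (intro centred_add_indep centred_gaussian_noise)
  moreover have "indep_var borel \<epsilon> borel (\<lambda>\<omega>. u \<bullet> e\<^sub>S \<omega> + w \<bullet> e\<^sub>T \<omega>)"
  proof -
    have "(\<lambda>p. u \<bullet> (fst p - m\<^sub>S) + w \<bullet> (snd p - m\<^sub>T)) \<in> borel_measurable borel"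
      by (intro borel_measurable_continuous_onI continuous_intros)
    from indep_var_compose_indep_borel[OF indep_new _ this, of "\<lambda>z. z"]
    show ?thesis
      by (simp add: e)
  qed
  moreover have "centred M \<epsilon> (\<sigma>\<^sub>T\<^sup>2)"
    using indep_new assms by (intro centred_normal_law) (auto simp: indep_borel_def)
  ultimately have "centred M ?Z (\<sigma>\<^sub>T\<^sup>2 + (\<sigma>\<^sub>S\<^sup>2 * (norm u)\<^sup>2 + \<sigma>\<^sub>T\<^sup>2 * (norm w)\<^sup>2))"
    by (intro centred_add_indep[where Z = \<epsilon>])
  then have Z: "has_bochner_integral M ?Z 0"
    "has_bochner_integral M (\<lambda>\<omega>. (?Z \<omega>)\<^sup>2) (\<sigma>\<^sub>T\<^sup>2 + (\<sigma>\<^sub>S\<^sup>2 * (norm u)\<^sup>2 + \<sigma>\<^sub>T\<^sup>2 * (norm w)\<^sup>2))"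
    by (auto simp: centred_def)
  have "expectation (\<lambda>\<omega>. (c + ?Z \<omega>)\<^sup>2) = expectation (\<lambda>\<omega>. c\<^sup>2 + 2 * c * ?Z \<omega> + (?Z \<omega>)\<^sup>2)"
    by (simp only: power2_sum add_ac)
  also have "\<dots> = c\<^sup>2 + 2 * c * expectation ?Z + expectation (\<lambda>\<omega>. (?Z \<omega>)\<^sup>2)"
    using Z by (simp add: has_bochner_integral_iff prob_space)
  finally show ?thesis
    using Z[THEN has_bochner_integral_integral_eq] by simp
qed

section \<open>The transfer gain\<close>

theorem proposition2:
  fixes M :: "'w measure"
    and X\<^sub>S :: "real ^ 'd ^ 's" and X\<^sub>T :: "real ^ 'd ^ 't"
    and \<beta>\<^sub>S \<beta>\<^sub>T :: "real ^ 'd"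
    and \<sigma>\<^sub>S \<sigma>\<^sub>T \<alpha> :: real
    and \<epsilon>\<^sub>S Y\<^sub>S :: "'w \<Rightarrow> real ^ 's" and \<epsilon>\<^sub>T Y\<^sub>T :: "'w \<Rightarrow> real ^ 't"
    and \<epsilon> y :: "'w \<Rightarrow> real"
    and b\<^sub>S b\<^sub>T b :: "'w \<Rightarrow> real ^ 'd"
    and x :: "real ^ 'd"
    and k :: nat
  assumes "prob_space M"
    and "CARD('d) < CARD('s)" and "CARD('d) < CARD('t)"
    and "rank X\<^sub>S = CARD('d)" and "rank X\<^sub>T = CARD('d)"
    and "\<sigma>\<^sub>S \<ge> 0" and "\<sigma>\<^sub>T \<ge> 0" and "\<alpha> > 0"
    and "gaussian_noise M \<sigma>\<^sub>S \<epsilon>\<^sub>S" and "gaussian_noise M \<sigma>\<^sub>T \<epsilon>\<^sub>T"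
    and "\<And>\<omega>. Y\<^sub>S \<omega> = X\<^sub>S *v \<beta>\<^sub>S + \<epsilon>\<^sub>S \<omega>" and "\<And>\<omega>. Y\<^sub>T \<omega> = X\<^sub>T *v \<beta>\<^sub>T + \<epsilon>\<^sub>T \<omega>"
    and "indep_borel M Y\<^sub>S Y\<^sub>T"
    and "distr M borel \<epsilon> = normal_law 0 \<sigma>\<^sub>T"
    and "indep_borel M \<epsilon> (\<lambda>\<omega>. (Y\<^sub>S \<omega>, Y\<^sub>T \<omega>))"
    and "\<And>\<omega>. y \<omega> = x \<bullet> \<beta>\<^sub>T + \<epsilon> \<omega>"
    and "\<And>\<omega>. b\<^sub>S \<omega> = least_squares X\<^sub>S (Y\<^sub>S \<omega>)"
    and "\<And>\<omega>. b\<^sub>T \<omega> = least_squares X\<^sub>T (Y\<^sub>T \<omega>)"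
    and "\<And>\<omega>. b \<omega> = grad_descent \<alpha> (half_square_loss X\<^sub>T (Y\<^sub>T \<omega>)) (b\<^sub>S \<omega>) k"
  defines "A \<equiv> descent_matrix \<alpha> X\<^sub>T"
    and "H \<equiv> gain_matrix \<alpha> X\<^sub>S X\<^sub>T \<beta>\<^sub>S \<beta>\<^sub>T \<sigma>\<^sub>S \<sigma>\<^sub>T k"
  shows "(\<forall>\<omega>. b \<omega> = mat_pow A k *v b\<^sub>S \<omega> + (mat 1 - mat_pow A k) *v b\<^sub>T \<omega>) \<and>
    transfer_gain M y x b\<^sub>T b = x \<bullet> (H *v x) \<and>
    (transfer_beneficial M y x b\<^sub>T b \<longleftrightarrow> 0 < x \<bullet> (H *v x))"
proof -
  interpret prob_space M
    by (rule assms(1))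
  let ?P = "mat_pow A k"
  let ?u = "?P *v x" and ?w = "(mat 1 - ?P) *v x"
  let ?weights\<^sub>S = "\<lambda>v. X\<^sub>S *v (matrix_inv (gram X\<^sub>S) *v v)"
  let ?weights\<^sub>T = "\<lambda>v. X\<^sub>T *v (matrix_inv (gram X\<^sub>T) *v v)"
  note risk = expectation_square_noise[OF assms(6,7,9,10,11,12,13,14,15)]
  have iterate: "b \<omega> = ?P *v b\<^sub>S \<omega> + (mat 1 - ?P) *v b\<^sub>T \<omega>" for \<omega>
    by (simp add: A_def assms(18,19) grad_descent_half_square_loss[OF assms(5)])
  have "transpose A = A"
    by (simp add: A_def descent_matrix_def transpose_diff transpose_scalar transpose_gram)
  then have symP: "transpose ?P = ?P"
    by (rule transpose_mat_pow)
  then have symQ: "transpose (mat 1 - ?P) = mat 1 - ?P"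
    by (simp add: transpose_diff)
  \<comment> \<open>The target estimator is the case without bias and with zero weights on the source noise.\<close>
  have "y \<omega> - x \<bullet> b\<^sub>T \<omega> = 0 + (\<epsilon> \<omega> + (0 \<bullet> \<epsilon>\<^sub>S \<omega> + (- ?weights\<^sub>T x) \<bullet> \<epsilon>\<^sub>T \<omega>))" for \<omega>
    by (simp add: assms(12,16,18) inner_least_squares[OF assms(5)])
  then have risk_target: "prediction_risk M y x b\<^sub>T =
      \<sigma>\<^sub>T\<^sup>2 + \<sigma>\<^sub>T\<^sup>2 * (x \<bullet> (matrix_inv (gram X\<^sub>T) *v x))"
    unfolding prediction_risk_def
    by (simp only: risk norm_minus_cancel norm_least_squares_weights[OF assms(5)]) simp
  have "y \<omega> - x \<bullet> b \<omega> = ?u \<bullet> (\<beta>\<^sub>T - \<beta>\<^sub>S) +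
      (\<epsilon> \<omega> + ((- ?weights\<^sub>S ?u) \<bullet> \<epsilon>\<^sub>S \<omega> + (- ?weights\<^sub>T ?w) \<bullet> \<epsilon>\<^sub>T \<omega>))" for \<omega>
  proof -
    have "x \<bullet> b \<omega> = ?u \<bullet> b\<^sub>S \<omega> + ?w \<bullet> b\<^sub>T \<omega>"
      by (simp only: iterate inner_add_right inner_symmetric_matrix_vector[OF symP]
          inner_symmetric_matrix_vector[OF symQ])
    also have "?u \<bullet> b\<^sub>S \<omega> = ?u \<bullet> \<beta>\<^sub>S + ?weights\<^sub>S ?u \<bullet> \<epsilon>\<^sub>S \<omega>"
      by (simp only: assms(11,17) inner_least_squares[OF assms(4)])
    also have "?w \<bullet> b\<^sub>T \<omega> = ?w \<bullet> \<beta>\<^sub>T + ?weights\<^sub>T ?w \<bullet> \<epsilon>\<^sub>T \<omega>"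
      by (simp only: assms(12,18) inner_least_squares[OF assms(5)])
    also have "?w \<bullet> \<beta>\<^sub>T = x \<bullet> \<beta>\<^sub>T - ?u \<bullet> \<beta>\<^sub>T"
      by (simp add: matrix_vector_mult_diff_rdistrib inner_diff_left)
    finally show ?thesis
      by (simp only: assms(16) inner_diff_right inner_minus_left)
  qed
  then have risk_tuned: "prediction_risk M y x b =
      (?u \<bullet> (\<beta>\<^sub>T - \<beta>\<^sub>S))\<^sup>2 + \<sigma>\<^sub>T\<^sup>2 + \<sigma>\<^sub>S\<^sup>2 * (?u \<bullet> (matrix_inv (gram X\<^sub>S) *v ?u))
      + \<sigma>\<^sub>T\<^sup>2 * (?w \<bullet> (matrix_inv (gram X\<^sub>T) *v ?w))"
    unfolding prediction_risk_def
    by (simp only: risk norm_minus_cancel norm_least_squares_weights[OF assms(4)]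
        norm_least_squares_weights[OF assms(5)])
  have gain: "transfer_gain M y x b\<^sub>T b = x \<bullet> (H *v x)"
    using assms(8) gain_matrix_quadratic_form[OF assms(5), of \<alpha> x X\<^sub>S \<beta>\<^sub>S \<beta>\<^sub>T \<sigma>\<^sub>S \<sigma>\<^sub>T k]
    by (simp add: transfer_gain_def risk_target risk_tuned H_def A_def algebra_simps)
  moreover have "transfer_beneficial M y x b\<^sub>T b \<longleftrightarrow> 0 < x \<bullet> (H *v x)"
    using gain by (auto simp: transfer_beneficial_def transfer_gain_def)
  ultimately show ?thesis
    using iterate by blast
qed

end
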